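(* Let $m$ be a positive integer and let $\mathbf{u}=(x_1,x_2,x_3)\in\mathbb{Z}_m^3$ be such that $x_1+x_2+x_3\equiv 0 \pmod m$. Then: (1) Every tuple $\mathbf{v}=(x_1',x_2',x_3')$ in the Ducci sequence of $\mathbf{u}$ satisfies $x_1'+x_2'+x_3'\equiv 0 \pmod m$. (2) $D^2(\mathbf{u})=H(\mathbf{u})$. (3) $\mathbf{u}$ belongs to a Ducci cycle. (4) If $m$ is odd, then unless $x_1=x_2=x_3$, $\mathrm{Per}(\mathbf{u})=6$. (5) If $m$ is even and $x_1,x_2,x_3$ are not all equal, then either $\mathrm{Per}(\mathbf{u})=6$, or $\mathrm{Per}(\mathbf{u})=3$ and $x_1,x_2,x_3\in\{0,\frac{m}{2}\}$.
   Context: $\mathbb{Z}_m=\mathbb{Z}/m\mathbb{Z}$, with elements represented by $0,1,\dots,m-1$. The Ducci function $D:\mathbb{Z}_m^n\to\mathbb{Z}_m^n$ is $D(x_1,x_2,\dots,x_n)=(x_1+x_2,\;x_2+x_3,\;\dots,\;x_n+x_1)$ (entries reduced mod $m$); here $n=3$. The Ducci sequence of $\mathbf{u}$ is $\{D^{\alpha}(\mathbf{u})\}_{\alpha=0}^{\infty}$. The Ducci cycle of $\mathbf{u}$ is the set of $\mathbf{v}$ for which there exist integers $\alpha\ge 0$, $\beta\ge 1$ with $\mathbf{v}=D^{\alpha+\beta}(\mathbf{u})=D^{\alpha}(\mathbf{u})$; a tuple belongs to a Ducci cycle if it lies in the Ducci cycle of some element of $\mathbb{Z}_m^n$. $\mathrm{Per}(\mathbf{u})$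 is the smallest $\beta\ge 1$ such that $D^{\alpha+\beta}(\mathbf{u})=D^{\alpha}(\mathbf{u})$ for some $\alpha\ge 0$. The map $H:\mathbb{Z}_m^n\to\mathbb{Z}_m^n$ is $H(x_1,x_2,\dots,x_n)=(x_2,x_3,\dots,x_n,x_1)$. *)

theory Defs
  imports "HOL-Number_Theory.Residues"
begin

definition Zm_tuples :: "int \<Rightarrow> nat \<Rightarrow> int list set" where
  "Zm_tuples m n = {xs. length xs = n \<and> set xs \<subseteq> carrier (residue_ring m)}"

definition ducci :: "int \<Rightarrow> int list \<Rightarrow> int list" where
  "ducci m xs = map2 (\<lambda>x y. x \<oplus>\<^bsub>residue_ring m\<^esub> y) xs (rotate1 xs)"

definition ducci_seq :: "int \<Rightarrow> int list \<Rightarrow> nat \<Rightarrow> int list" where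
  "ducci_seq m u \<alpha> = (ducci m ^^ \<alpha>) u"

definition ducci_cycle :: "int \<Rightarrow> int list \<Rightarrow> int list set" where
  "ducci_cycle m u =
     {v. \<exists>\<alpha> \<beta>. \<beta> \<ge> 1 \<and> v = ducci_seq m u (\<alpha> + \<beta>) \<and> v = ducci_seq m u \<alpha>}"

definition in_ducci_cycle :: "int \<Rightarrow> nat \<Rightarrow> int list \<Rightarrow> bool" where
  "in_ducci_cycle m n v \<longleftrightarrow> (\<exists>u \<in> Zm_tuples m n. v \<in> ducci_cycle m u)"

(* For m > 0 the set Zm_tuples m n is finite and closed under ducci m, so a suitable
   period exists for each of its elements and LEAST is meaningful there. *)
definition Per :: "int \<Rightarrow> int list \<Rightarrow> nat" where
  "Per m u = (LEAST \<beta>. \<beta> \<ge> 1 \<and> (\<exists>\<alpha>. ducci_seq m u (\<alpha> + \<beta>) = ducci_seq m u \<alpha>))"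

lemma ducci_in_Zm_tuples:
  assumes "m > 0" "u \<in> Zm_tuples m n"
  shows "ducci m u \<in> Zm_tuples m n"
  using assms by (auto simp: Zm_tuples_def ducci_def residue_ring_def)

lemma ducci_seq_in_Zm_tuples:
  assumes "m > 0" "u \<in> Zm_tuples m n"
  shows "ducci_seq m u \<alpha> \<in> Zm_tuples m n"
  using assms by (induction \<alpha>) (auto simp: ducci_seq_def ducci_in_Zm_tuples)

lemma ducci_triple:
  "ducci m [x, y, z] = [(x + y) mod m, (y + z) mod m, (z + x) mod m]"
  by (simp add: ducci_def residue_ring_def)

end

theory Submission
  imports Defs
begin

text \<open>
  On triples with sum zero, \<open>x + y = - z\<close>, so the Ducci map \<open>D\<close> is minus the inverse of the
  rotation \<open>H\<close>. Since \<open>H\<close> has order three, \<open>D\<^sup>2\<close> is \<open>H\<close>, \<open>D\<^sup>3\<close> is negation and \<open>D\<^sup>6\<close> is the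
  identity (\<open>ducci_pow2_eq_rotate1\<close>, \<open>ducci_pow3_eq_uminus\<close>, \<open>ducci_pow6_eq_id\<close>). In particular
  every zero-sum triple is purely periodic, and hence lies on its own cycle.

  For a purely periodic tuple, the period divides exactly those exponents whose power of \<open>D\<close>
  fixes the tuple (\<open>Per_dvd_iff\<close>). So the period of a zero-sum triple is a divisor of six: it
  is 1 or 2 only if rotation fixes the triple, which means that its entries agree, and it is 3
  only if negation fixes the triple, which means that every entry is killed by 2. For odd \<open>m\<close>
  the only such residue is 0, and for even \<open>m\<close> there is one more, \<open>m div 2\<close>.
\<close>

section \<open>The period of a purely periodic tuple\<close>

text \<open>
  No preperiod can occur once some iterate returns to \<open>u\<close>: moving a coincidence between later
  iterates forward to a multiple of \<open>N\<close> turns it into a return to \<open>u\<close>.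
\<close>

lemma funpow_eq_iff_fixed_if_periodic:
  assumes "N \<ge> 1" and "(f ^^ N) u = u"
  shows "(f ^^ (\<alpha> + \<beta>)) u = (f ^^ \<alpha>) u \<longleftrightarrow> (f ^^ \<beta>) u = u"
proof
  assume "(f ^^ \<beta>) u = u"
  then show "(f ^^ (\<alpha> + \<beta>)) u = (f ^^ \<alpha>) u"
    by (simp add: funpow_add)
next
  assume eq: "(f ^^ (\<alpha> + \<beta>)) u = (f ^^ \<alpha>) u"
  have fixed: "(f ^^ (N * \<alpha>)) u = u"
    using funpow_mod_eq[OF assms(2), of "N * \<alpha>"] by simp
  have split: "N * \<alpha> = (N * \<alpha> - \<alpha>) + \<alpha>"
    using assms(1) by simp
  have "(f ^^ \<beta>) u = (f ^^ \<beta>) ((f ^^ (N * \<alpha>)) u)"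
    using fixed by simp
  also have "\<dots> = (f ^^ (\<beta> + N * \<alpha>)) u"
    by (simp add: funpow_add)
  also have "\<beta> + N * \<alpha> = (N * \<alpha> - \<alpha>) + (\<alpha> + \<beta>)"
    using split by linarith
  also have "(f ^^ \<dots>) u = (f ^^ (N * \<alpha> - \<alpha>)) ((f ^^ \<alpha>) u)"
    using eq by (simp add: funpow_add)
  also have "\<dots> = (f ^^ (N * \<alpha>)) u"
    by (subst (2) split) (simp add: funpow_add)
  finally show "(f ^^ \<beta>) u = u"
    using fixed by simp
qed

text \<open>
  The exponents fixing \<open>u\<close> are closed under remainders, so their least positive element
  divides all of them.
\<close>

lemma Per_dvd_iff:
  assumes "N \<ge> 1" and "(ducci m ^^ N) u = u"
  shows "Per m u dvd \<beta> \<longleftrightarrow> (ducci m ^^ \<beta>) u = u"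
proof -
  define P where "P \<beta> \<longleftrightarrow> \<beta> \<ge> 1 \<and> (ducci m ^^ \<beta>) u = u" for \<beta>
  have Per_eq: "Per m u = (LEAST \<beta>. P \<beta>)"
    unfolding Per_def P_def ducci_seq_def
    using funpow_eq_iff_fixed_if_periodic[OF assms] by simp
  have "P N"
    using assms by (simp add: P_def)
  then have "P (Per m u)"
    unfolding Per_eq by (rule LeastI)
  then have pos: "Per m u \<ge> 1" and fixed: "(ducci m ^^ Per m u) u = u"
    by (simp_all add: P_def)
  have mod_eq: "(ducci m ^^ (\<beta> mod Per m u)) u = (ducci m ^^ \<beta>) u"
    using fixed by (rule funpow_mod_eq)
  show ?thesis
  proof
    assume "Per m u dvd \<beta>"
    then show "(ducci m ^^ \<beta>) u = u"
      using mod_eq by (simp add: dvd_eq_mod_eq_0)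
  next
    assume "(ducci m ^^ \<beta>) u = u"
    moreover have "\<not> P (\<beta> mod Per m u)"
      using not_less_Least[of "\<beta> mod Per m u" P] pos Per_eq by simp
    ultimately show "Per m u dvd \<beta>"
      using mod_eq by (simp add: P_def dvd_eq_mod_eq_0)
  qed
qed

section \<open>The Ducci map on triples with sum zero\<close>

lemma Zm_tuples_3_iff:
  "[x, y, z] \<in> Zm_tuples m 3 \<longleftrightarrow> {x, y, z} \<subseteq> {0..<m}"
  by (auto simp: Zm_tuples_def residue_ring_def)

text \<open>The Ducci map doubles the sum of the entries, which keeps the sum zero along a sequence.\<close>

lemma ducci_seq_sum_eq_0:
  assumes "[x + y + z = 0] (mod m)"
  shows "\<exists>x' y' z'. ducci_seq m [x, y, z] \<alpha> = [x', y', z'] \<and> [x' + y' + z' = 0] (mod m)"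
proof (induction \<alpha>)
  case 0
  then show ?case
    using assms by (simp add: ducci_seq_def)
next
  case (Suc \<alpha>)
  then obtain x' y' z' where seq: "ducci_seq m [x, y, z] \<alpha> = [x', y', z']"
    and zero: "[x' + y' + z' = 0] (mod m)"
    by blast
  have "[(x' + y') mod m + (y' + z') mod m + (z' + x') mod m
      = (x' + y') + (y' + z') + (z' + x')] (mod m)"
    by (intro cong_add) simp_all
  also have "(x' + y') + (y' + z') + (z' + x') = 2 * (x' + y' + z')"
    by simp
  also have "[2 * (x' + y' + z') = 2 * 0] (mod m)"
    using zero by (rule cong_scalar_left)
  finally show ?case
    using seq by (simp add: ducci_seq_def ducci_triple)
qed

lemma ducci_eq_uminus_inverse_rotation:
  assumes "[x + y + z = 0] (mod m)"
  shows "ducci m [x, y, z] = [- z mod m, - x mod m, - y mod m]"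
proof -
  have "m dvd x + y + z"
    using assms by (simp add: cong_0_iff)
  then show ?thesis
    by (simp add: ducci_triple mod_eq_dvd_iff algebra_simps)
qed

lemma ducci_pow2_eq_rotate1:
  assumes "[x, y, z] \<in> Zm_tuples m 3" and "[x + y + z = 0] (mod m)"
  shows "(ducci m ^^ 2) [x, y, z] = [y, z, x]"
proof -
  have "[- z mod m + - x mod m + - y mod m = - z + - x + - y] (mod m)"
    by (intro cong_add) simp_all
  also have "- z + - x + - y = - (x + y + z)"
    by simp
  also have "[- (x + y + z) = - 0] (mod m)"
    using assms(2) by (simp only: cong_minus_minus_iff)
  finally show ?thesis
    using assms
    by (simp add: numeral_2_eq_2 ducci_eq_uminus_inverse_rotation Zm_tuples_3_iff mod_minus_eq)
qed

lemma ducci_pow3_eq_uminus: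
  assumes "[x, y, z] \<in> Zm_tuples m 3" and "[x + y + z = 0] (mod m)"
  shows "(ducci m ^^ 3) [x, y, z] = [- x mod m, - y mod m, - z mod m]"
proof -
  have "(ducci m ^^ 3) [x, y, z] = ducci m ((ducci m ^^ 2) [x, y, z])"
    by (simp add: eval_nat_numeral)
  also have "\<dots> = ducci m [y, z, x]"
    using ducci_pow2_eq_rotate1[OF assms] by simp
  finally show ?thesis
    using assms(2) by (simp add: ducci_eq_uminus_inverse_rotation ac_simps)
qed

lemma ducci_pow6_eq_id:
  assumes "[x, y, z] \<in> Zm_tuples m 3" and "[x + y + z = 0] (mod m)"
  shows "(ducci m ^^ 6) [x, y, z] = [x, y, z]"
proof -
  have "(ducci m ^^ 6) [x, y, z] = (ducci m ^^ 2) ((ducci m ^^ 2) ((ducci m ^^ 2) [x, y, z]))"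
    by (simp add: eval_nat_numeral)
  also have "(ducci m ^^ 2) [x, y, z] = [y, z, x]"
    using assms by (rule ducci_pow2_eq_rotate1)
  also have "(ducci m ^^ 2) [y, z, x] = [z, x, y]"
    using assms by (intro ducci_pow2_eq_rotate1) (simp_all add: Zm_tuples_3_iff ac_simps)
  also have "(ducci m ^^ 2) [z, x, y] = [x, y, z]"
    using assms by (intro ducci_pow2_eq_rotate1) (simp_all add: Zm_tuples_3_iff ac_simps)
  finally show ?thesis .
qed

section \<open>The possible periods\<close>

lemma residue_eq_uminus_iff:
  fixes a m :: int
  assumes "a \<in> {0..<m}"
  shows "- a mod m = a \<longleftrightarrow> a = 0 \<or> 2 * a = m"
  using assms by (cases "a = 0") (auto simp: zmod_zminus1_eq_if)

lemma dvd_6_cases: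
  fixes p :: nat
  assumes "p dvd 6"
  shows "p dvd 2 \<or> p = 3 \<or> p = 6"
proof -
  have "p \<in> {..6}"
    using dvd_imp_le[OF assms] by simp
  then have "p \<in> {0, 1, 2, 3, 4, 5, 6}"
    by (auto simp: eval_nat_numeral atMost_Suc)
  with assms show ?thesis
    by auto
qed

text \<open>
  This settles odd and even moduli together: the parity of \<open>m\<close> only decides whether \<open>2 * a = m\<close>
  has a solution.
\<close>

lemma Per_zero_sum_triple:
  assumes "[x, y, z] \<in> Zm_tuples m 3" and "[x + y + z = 0] (mod m)"
    and "\<not> (x = y \<and> y = z)"
  shows "Per m [x, y, z] = 6
    \<or> Per m [x, y, z] = 3 \<and> (\<forall>a \<in> {x, y, z}. a = 0 \<or> 2 * a = m)"
proof -
  note Per_dvd = Per_dvd_iff[OF _ ducci_pow6_eq_id[OF assms(1,2)], simplified]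
  have "Per m [x, y, z] dvd 6"
    using ducci_pow6_eq_id[OF assms(1,2)] by (simp add: Per_dvd)
  moreover have "\<not> Per m [x, y, z] dvd 2"
    using ducci_pow2_eq_rotate1[OF assms(1,2)] assms(3) by (auto simp: Per_dvd)
  ultimately have cases: "Per m [x, y, z] = 3 \<or> Per m [x, y, z] = 6"
    using dvd_6_cases by blast
  have "\<forall>a \<in> {x, y, z}. a = 0 \<or> 2 * a = m" if "Per m [x, y, z] = 3"
  proof -
    have "(ducci m ^^ 3) [x, y, z] = [x, y, z]"
      using that Per_dvd[of 3] by simp
    then have "- a mod m = a" if "a \<in> {x, y, z}" for a
      using that ducci_pow3_eq_uminus[OF assms(1,2)] by auto
    then show ?thesis
      using assms(1) residue_eq_uminus_iff by (auto simp: Zm_tuples_3_iff)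
  qed
  with cases show ?thesis
    by blast
qed

theorem lemma2:
  fixes m :: int and x1 x2 x3 :: int and u :: "int list"
  assumes "m > 0"
    and "u = [x1, x2, x3]"
    and "u \<in> Zm_tuples m 3"
    and "[x1 + x2 + x3 = 0] (mod m)"
  shows "(\<forall>x1' x2' x3'. [x1', x2', x3'] \<in> range (ducci_seq m u) \<longrightarrow>
            [x1' + x2' + x3' = 0] (mod m))
       \<and> (ducci m ^^ 2) u = rotate1 u
       \<and> in_ducci_cycle m 3 u
       \<and> (odd m \<longrightarrow> \<not> (x1 = x2 \<and> x2 = x3) \<longrightarrow> Per m u = 6)
       \<and> (even m \<longrightarrow> \<not> (x1 = x2 \<and> x2 = x3) \<longrightarrow>
            Per m u = 6
            \<or> (Per m u = 3 \<and> x1 \<in> {0, m div 2} \<and> x2 \<in> {0, m div 2} \<and> x3 \<in> {0, m div 2}))"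
proof (intro conjI impI allI)
  have mem: "[x1, x2, x3] \<in> Zm_tuples m 3"
    using assms(2,3) by simp
  note Per_cases = Per_zero_sum_triple[OF mem assms(4), folded assms(2)]
  show "[x1' + x2' + x3' = 0] (mod m)" if seq: "[x1', x2', x3'] \<in> range (ducci_seq m u)"
    for x1' x2' x3'
  proof -
    from seq obtain \<alpha> where "ducci_seq m [x1, x2, x3] \<alpha> = [x1', x2', x3']"
      unfolding assms(2) by (metis imageE)
    then show ?thesis
      using ducci_seq_sum_eq_0[OF assms(4), of \<alpha>] by auto
  qed
  show "(ducci m ^^ 2) u = rotate1 u"
    using ducci_pow2_eq_rotate1[OF mem assms(4)] assms(2) by simp
  have "u = ducci_seq m u (0 + 6)" and "u = ducci_seq m u 0"
    using ducci_pow6_eq_id[OF mem assms(4)] assms(2) by (simp_all add: ducci_seq_def)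
  then have "u \<in> ducci_cycle m u"
    unfolding ducci_cycle_def by (intro CollectI exI[of _ 0] exI[of _ 6]) simp
  then show "in_ducci_cycle m 3 u"
    using assms(3) by (auto simp: in_ducci_cycle_def)
  show "Per m u = 6" if "odd m" and "\<not> (x1 = x2 \<and> x2 = x3)"
    using Per_cases[OF that(2)] that by auto
  show "Per m u = 6
      \<or> (Per m u = 3 \<and> x1 \<in> {0, m div 2} \<and> x2 \<in> {0, m div 2} \<and> x3 \<in> {0, m div 2})"
    if "even m" and "\<not> (x1 = x2 \<and> x2 = x3)"
    using Per_cases[OF that(2)] by auto
qed

end
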